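(* Let $H$ be an infinite-dimensional separable complex Hilbert space, let $T\in\mathcal{M}_r(H)$ be self-adjoint, and let $\Gamma:=\{|\lambda|:\lambda\in\sigma_p(T)\}\subseteq[0,\|T\|]$. Then the following hold: (i) $T$ is diagonalizable, i.e. $H$ has an orthonormal basis consisting of eigenvectors of $T$; (ii) $\Gamma$ is a countable subset of $[0,\|T\|]$ that is well-ordered by the usual order of $\mathbb{R}$; (iii) if $P_\lambda$ denotes the orthogonal projection onto $N(T-\lambda I)$ for each $\lambda\in\sigma_p(T)$, then $$T=\sum_{\lambda\in\sigma_p(T)}\lambda P_\lambda\quad\text{and}\quad |T|=\sum_{\lambda\in\sigma_p(T)}|\lambda|P_\lambda,$$ where both series converge in the strong operator topology.
   Context: $\mathcal{B}(H)$ denotes the bounded linear operators on $H$; $|T|=(T^*T)^{1/2}$; $\sigma_p(T)$ is the set of eigenvalues of $T$; $N$ denotes the kernel. For a nonzero Hilbert space $M$ and $A\in\mathcal{B}(M)$, the minimum modulus is $m(A)=\inf\{\|Ax\|: x\in M,\ \|x\|=1\}$; $A$ is minimum attaining if there is a unit vector $x_0\in M$ with $\|Ax_0\|=m(A)$. A closed subspace $M\subseteq H$ reduces $T\in\mathcal{B}(H)$ if $T(M)\subseteq M$ and $T^*(M)\subseteq M$. $\mathcal{M}_r(H)$ is the set of all $T\in\mathcal{B}(H)$ such that for every nonzero closed subspace $M$ reducing $T$, the restriction $T|_M:M\to M$ is minimum attaining. *)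

theory Defs
  imports "HOL-Analysis.Analysis"
begin

text \<open>Complex Hilbert spaces, on top of the real normed spaces of HOL-Analysis. The scalar
  product is linear in its first argument. Its definiteness is not a separate axiom, since it
  follows from the axiom \<open>cinner_self\<close> and the norm axioms.\<close>

class complex_inner = real_normed_vector +
  fixes scaleC :: "complex \<Rightarrow> 'a \<Rightarrow> 'a"  (infixr \<open>*\<^sub>C\<close> 75)
    and cinner :: "'a \<Rightarrow> 'a \<Rightarrow> complex"
  assumes scaleC_add_right: "a *\<^sub>C (x + y) = a *\<^sub>C x + a *\<^sub>C y"
    and scaleC_add_left: "(a + b) *\<^sub>C x = a *\<^sub>C x + b *\<^sub>C x"
    and scaleC_scaleC: "a *\<^sub>C b *\<^sub>C x = (a * b) *\<^sub>C x"
    and scaleC_one: "1 *\<^sub>C x = x"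
    and scaleC_of_real: "complex_of_real r *\<^sub>C x = r *\<^sub>R x"
    and cinner_add_left: "cinner (x + y) z = cinner x z + cinner y z"
    and cinner_scaleC_left: "cinner (a *\<^sub>C x) y = a * cinner x y"
    and cinner_commute: "cinner x y = cnj (cinner y x)"
    and cinner_self: "cinner x x = complex_of_real ((norm x)\<^sup>2)"

class chilbert_space = complex_inner + complete_space

global_interpretation complex_vector: vector_space "scaleC :: complex \<Rightarrow> 'a \<Rightarrow> 'a::complex_inner"
  defines csubspace = complex_vector.subspace
    and cspan = complex_vector.span
  by unfold_locales (simp_all add: scaleC_add_right scaleC_add_left scaleC_scaleC scaleC_one)

lemma norm_scaleC: "norm (a *\<^sub>C x) = cmod a * norm x"
  for x :: "'a::complex_inner"
proof -
  have "cinner (a *\<^sub>C x) (a *\<^sub>C x) = a * cnj a * cinner x x"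
    using cinner_commute[of x "a *\<^sub>C x"] cinner_commute[of x x]
    by (simp add: cinner_scaleC_left)
  then have "complex_of_real ((norm (a *\<^sub>C x))\<^sup>2) = complex_of_real ((cmod a * norm x)\<^sup>2)"
    by (simp add: cinner_self complex_mult_cnj cmod_power2 power_mult_distrib)
  then have "(norm (a *\<^sub>C x))\<^sup>2 = (cmod a * norm x)\<^sup>2"
    by (simp only: of_real_eq_iff)
  then show ?thesis
    by (simp add: power2_eq_iff_nonneg)
qed

lemma bounded_linear_scaleC: "bounded_linear (\<lambda>x::'a::complex_inner. a *\<^sub>C x)"
proof (rule bounded_linear_intro[where K = "cmod a"])
  show "a *\<^sub>C r *\<^sub>R x = r *\<^sub>R a *\<^sub>C x" for r and x :: 'a
    by (simp add: scaleC_of_real[symmetric] scaleC_scaleC mult.commute)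
qed (simp_all add: scaleC_add_right norm_scaleC mult.commute)

definition infinite_dimensional :: "'a::complex_inner itself \<Rightarrow> bool" where
  "infinite_dimensional _ \<longleftrightarrow> \<not> (\<exists>B::'a set. finite B \<and> cspan B = UNIV)"

definition orthonormal_basis :: "'a::complex_inner set \<Rightarrow> bool" where
  "orthonormal_basis B \<longleftrightarrow>
     (\<forall>b\<in>B. norm b = 1) \<and> (\<forall>b\<in>B. \<forall>c\<in>B. b \<noteq> c \<longrightarrow> cinner b c = 0) \<and> closure (cspan B) = UNIV"

text \<open>The library type \<open>'a \<Rightarrow>\<^sub>L 'a\<close> consists of the bounded real-linear maps;
  \<open>bounded_ops\<close> singles out the complex-linear ones.\<close>

definition bounded_ops :: "('a::complex_inner \<Rightarrow>\<^sub>L 'a) set" where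
  "bounded_ops = {T. Vector_Spaces.linear (*\<^sub>C) (*\<^sub>C) (blinfun_apply T)}"

lift_definition scaleC_op ::
  "complex \<Rightarrow> ('a::complex_inner \<Rightarrow>\<^sub>L 'a) \<Rightarrow> ('a \<Rightarrow>\<^sub>L 'a)" is "\<lambda>c T x. c *\<^sub>C T x"
  by (rule bounded_linear_compose[OF bounded_linear_scaleC])

definition adj_op :: "('a::chilbert_space \<Rightarrow>\<^sub>L 'a) \<Rightarrow> ('a \<Rightarrow>\<^sub>L 'a)" where
  "adj_op T = (THE S. S \<in> bounded_ops \<and> (\<forall>x y. cinner (T x) y = cinner x (S y)))"

definition self_adjoint :: "('a::chilbert_space \<Rightarrow>\<^sub>L 'a) \<Rightarrow> bool" where
  "self_adjoint T \<longleftrightarrow> adj_op T = T"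

definition positive_op :: "('a::chilbert_space \<Rightarrow>\<^sub>L 'a) \<Rightarrow> bool" where
  "positive_op T \<longleftrightarrow> T \<in> bounded_ops \<and> (\<forall>x. cinner (T x) x \<in> \<real>\<^sub>\<ge>\<^sub>0)"

definition sqrt_op :: "('a::chilbert_space \<Rightarrow>\<^sub>L 'a) \<Rightarrow> ('a \<Rightarrow>\<^sub>L 'a)" where
  "sqrt_op A = (THE S. positive_op S \<and> S o\<^sub>L S = A)"

definition abs_op :: "('a::chilbert_space \<Rightarrow>\<^sub>L 'a) \<Rightarrow> ('a \<Rightarrow>\<^sub>L 'a)" where
  "abs_op T = sqrt_op (adj_op T o\<^sub>L T)"

definition kernel :: "('a::complex_inner \<Rightarrow>\<^sub>L 'a) \<Rightarrow> 'a set" where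
  "kernel T = {x. T x = 0}"

definition eigenspace :: "('a::complex_inner \<Rightarrow>\<^sub>L 'a) \<Rightarrow> complex \<Rightarrow> 'a set" where
  "eigenspace T l = kernel (T - scaleC_op l id_blinfun)"

definition point_spectrum :: "('a::complex_inner \<Rightarrow>\<^sub>L 'a) \<Rightarrow> complex set" where
  "point_spectrum T = {l. \<exists>x. x \<noteq> 0 \<and> T x = l *\<^sub>C x}"

definition diagonalizable :: "('a::complex_inner \<Rightarrow>\<^sub>L 'a) \<Rightarrow> bool" where
  "diagonalizable T \<longleftrightarrow>
     (\<exists>B. orthonormal_basis B \<and> (\<forall>b\<in>B. b \<noteq> 0 \<and> (\<exists>l. T b = l *\<^sub>C b)))"

text \<open>Orthogonal projection onto a closed subspace \<open>M\<close>; \<open>M\<close> is meant to be closed, and the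
  map then is bounded, so that \<open>Blinfun\<close> returns it unchanged.\<close>

definition orth_proj :: "'a::chilbert_space set \<Rightarrow> ('a \<Rightarrow>\<^sub>L 'a)" where
  "orth_proj M = Blinfun (\<lambda>x. THE y. y \<in> M \<and> (\<forall>z\<in>M. cinner (x - y) z = 0))"

definition reduces :: "'a::chilbert_space set \<Rightarrow> ('a \<Rightarrow>\<^sub>L 'a) \<Rightarrow> bool" where
  "reduces M T \<longleftrightarrow>
     csubspace M \<and> closed M \<and> blinfun_apply T ` M \<subseteq> M \<and> blinfun_apply (adj_op T) ` M \<subseteq> M"

definition min_modulus_on :: "'a::complex_inner set \<Rightarrow> ('a \<Rightarrow>\<^sub>L 'a) \<Rightarrow> real" where
  "min_modulus_on M T = (INF x\<in>{x\<in>M. norm x = 1}. norm (T x))"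

definition min_attaining_on :: "'a::complex_inner set \<Rightarrow> ('a \<Rightarrow>\<^sub>L 'a) \<Rightarrow> bool" where
  "min_attaining_on M T \<longleftrightarrow> (\<exists>x\<in>M. norm x = 1 \<and> norm (T x) = min_modulus_on M T)"

definition M_r :: "('a::chilbert_space \<Rightarrow>\<^sub>L 'a) set" where
  "M_r = {T \<in> bounded_ops. \<forall>M. M \<noteq> {0} \<and> reduces M T \<longrightarrow> min_attaining_on M T}"

text \<open>Unordered convergence, i.e. of the net of finite partial sums, in the strong operator
  topology; it implies convergence to the same sum along every enumeration of \<open>A\<close>.\<close>

definition has_sum_sot ::
  "('i \<Rightarrow> ('a::chilbert_space \<Rightarrow>\<^sub>L 'a)) \<Rightarrow> ('a \<Rightarrow>\<^sub>L 'a) \<Rightarrow> 'i set \<Rightarrow> bool" where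
  "has_sum_sot f S A \<longleftrightarrow>
     limitin strong_operator_topology (\<lambda>F. \<Sum>i\<in>F. f i) S (finite_subsets_at_top A)"

end

theory Submission
  imports Defs
begin

text \<open>If \<open>X\<close> is a set of eigenvectors, \<open>X\<^sup>\<bottom>\<close> reduces \<open>T\<close>. Where \<open>T\<close> attains its minimum modulus \<open>m\<close>
  on \<open>X\<^sup>\<bottom>\<close>, the nonnegative quadratic form \<open>\<parallel>T x\<parallel>\<^sup>2 - m\<^sup>2 \<parallel>x\<parallel>\<^sup>2\<close> vanishes, so there \<open>T\<^sup>2 x = m\<^sup>2 x\<close>,
  and \<open>X\<^sup>\<bottom>\<close> contains an eigenvector for \<open>m\<close> or \<open>-m\<close>. Applied to a maximal orthonormal set \<open>X\<close> of
  eigenvectors this gives diagonalizability. Applied to the set \<open>X\<close> of eigenvectors whose moduli lie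
  outside a given nonempty set \<open>S\<close> of moduli of eigenvalues, it gives a least element of \<open>S\<close>. The
  series in (iii) reduce to \<open>\<Sum> P\<^sub>\<lambda> x = x\<close>, which holds since finite partial sums are best approximations
  from sums of eigenspaces.\<close>

subsection \<open>Orthogonality and projections in complex Hilbert spaces\<close>

lemma cinner_add_right: "cinner x (y + z) = cinner x y + cinner x z"
  for x :: "'a::complex_inner"
  by (metis cinner_add_left cinner_commute complex_cnj_add)

lemma cinner_scaleC_right: "cinner x (a *\<^sub>C y) = cnj a * cinner x y"
  for x :: "'a::complex_inner"
  by (metis cinner_scaleC_left cinner_commute complex_cnj_mult)

lemma cinner_scaleR_left: "cinner (r *\<^sub>R x) y = of_real r * cinner x y"
  for x :: "'a::complex_inner"
  by (metis cinner_scaleC_left scaleC_of_real)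

lemma cinner_scaleR_right: "cinner x (r *\<^sub>R y) = of_real r * cinner x y"
  for x :: "'a::complex_inner"
  by (metis cinner_scaleC_right scaleC_of_real complex_cnj_complex_of_real)

lemma cinner_minus_left: "cinner (- x) y = - cinner x y"
  for x :: "'a::complex_inner"
  using cinner_scaleR_left[of "-1" x y] by simp

lemma cinner_minus_right: "cinner x (- y) = - cinner x y"
  for x :: "'a::complex_inner"
  using cinner_scaleR_right[of x "-1" y] by simp

lemma cinner_diff_left: "cinner (x - y) z = cinner x z - cinner y z"
  for x :: "'a::complex_inner"
  using cinner_add_left[of x "- y" z] by (simp add: cinner_minus_left)

lemma cinner_diff_right: "cinner x (y - z) = cinner x y - cinner x z"
  for x :: "'a::complex_inner"
  using cinner_add_right[of x y "- z"] by (simp add: cinner_minus_right)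

lemma cinner_zero_left [simp]: "cinner 0 y = 0"
  using cinner_add_left[of 0 0 y] by simp

lemma cinner_zero_right [simp]: "cinner x 0 = 0"
  using cinner_add_right[of x 0 0] by simp

lemma cinner_sum_left: "cinner (\<Sum>i\<in>F. f i) y = (\<Sum>i\<in>F. cinner (f i) y)"
  for y :: "'a::complex_inner"
  by (induction F rule: infinite_finite_induct) (simp_all add: cinner_add_left)

lemma cinner_sum_right: "cinner x (\<Sum>i\<in>F. f i) = (\<Sum>i\<in>F. cinner x (f i))"
  for x :: "'a::complex_inner"
  by (induction F rule: infinite_finite_induct) (simp_all add: cinner_add_right)

lemma cinner_self_eq_0 [simp]: "cinner x x = 0 \<longleftrightarrow> x = 0"
  for x :: "'a::complex_inner"
  by (simp add: cinner_self)

lemma cinner_eq_0_commute: "cinner x y = 0 \<longleftrightarrow> cinner y x = 0"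
  for x :: "'a::complex_inner"
  by (metis cinner_commute complex_cnj_zero)

lemma norm_add_squared: "(norm (x + y))\<^sup>2 = (norm x)\<^sup>2 + (norm y)\<^sup>2 + 2 * Re (cinner x y)"
  for x :: "'a::complex_inner"
proof -
  have "Re (cinner y x) = Re (cinner x y)"
    using cinner_commute[of y x] by simp
  moreover have "Re (cinner (x + y) (x + y)) = (norm (x + y))\<^sup>2"
    "Re (cinner x x) = (norm x)\<^sup>2" "Re (cinner y y) = (norm y)\<^sup>2"
    by (simp_all add: cinner_self)
  ultimately show ?thesis
    by (simp add: cinner_add_left cinner_add_right)
qed

lemma norm_diff_squared: "(norm (x - y))\<^sup>2 = (norm x)\<^sup>2 + (norm y)\<^sup>2 - 2 * Re (cinner x y)"
  for x :: "'a::complex_inner"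
  using norm_add_squared[of x "- y"] by (simp add: cinner_minus_right)

text \<open>Cauchy-Schwarz: \<open>t\<close> is the coefficient for which
  \<open>x - t *\<^sub>C y\<close> is orthogonal to \<open>y\<close>, so by Pythagoras the component
  of \<open>x\<close> along \<open>y\<close> is no longer than \<open>x\<close>.\<close>

lemma norm_cinner_le: "cmod (cinner x y) \<le> norm x * norm y"
  for x :: "'a::complex_inner"
proof (cases "y = 0")
  case False
  define t where "t = cinner x y / of_real ((norm y)\<^sup>2)"
  have "cinner (x - t *\<^sub>C y) y = 0"
    using False by (simp add: cinner_diff_left cinner_scaleC_left cinner_self t_def)
  then have "(norm ((x - t *\<^sub>C y) + t *\<^sub>C y))\<^sup>2 = (norm (x - t *\<^sub>C y))\<^sup>2 + (norm (t *\<^sub>C y))\<^sup>2"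
    unfolding norm_add_squared by (simp add: cinner_scaleC_right)
  then have "(norm (t *\<^sub>C y))\<^sup>2 \<le> (norm x)\<^sup>2"
    by simp
  then have "norm (t *\<^sub>C y) \<le> norm x"
    by (simp add: power2_le_iff_abs_le)
  moreover have "norm (t *\<^sub>C y) = cmod (cinner x y) / norm y"
    using False by (simp add: norm_scaleC t_def norm_divide norm_mult power2_eq_square)
  ultimately show ?thesis
    using False by (simp add: divide_le_eq)
qed simp

lemma bounded_linear_cinner_left: "bounded_linear (\<lambda>x::'a::complex_inner. cinner x y)"
proof (rule bounded_linear_intro[where K = "norm y"])
  show "cinner (r *\<^sub>R x) y = r *\<^sub>R cinner x y" for r and x :: 'a
    by (simp add: cinner_scaleR_left scaleR_conv_of_real)
qed (simp_all add: cinner_add_left norm_cinner_le)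

section \<open>Closed complex subspaces and orthogonal complements\<close>

lemma scaleR_in_csubspace: "csubspace M \<Longrightarrow> x \<in> M \<Longrightarrow> r *\<^sub>R x \<in> M"
  by (metis complex_vector.subspace_scale scaleC_of_real)

lemma csubspace_closure:
  assumes "csubspace M"
  shows "csubspace (closure M)"
proof (rule complex_vector.subspaceI)
  show "0 \<in> closure M"
    using assms complex_vector.subspace_0 closure_subset by blast
next
  fix x y assume "x \<in> closure M" "y \<in> closure M"
  then obtain f g where "\<forall>n. f n \<in> M" "f \<longlonglongrightarrow> x" "\<forall>n. g n \<in> M" "g \<longlonglongrightarrow> y"
    by (auto simp: closure_sequential)
  then show "x + y \<in> closure M"
    unfolding closure_sequential
    by (intro exI[of _ "\<lambda>n. f n + g n"]) (simp add: tendsto_add complex_vector.subspace_add assms)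
next
  fix c x assume "x \<in> closure M"
  then obtain f where "\<forall>n. f n \<in> M" "f \<longlonglongrightarrow> x"
    by (auto simp: closure_sequential)
  then show "c *\<^sub>C x \<in> closure M"
    unfolding closure_sequential
    by (intro exI[of _ "\<lambda>n. c *\<^sub>C f n"])
      (simp add: bounded_linear.tendsto[OF bounded_linear_scaleC] complex_vector.subspace_scale assms)
qed

definition orth_compl :: "'a::complex_inner set \<Rightarrow> 'a set" where
  "orth_compl X = {x. \<forall>b\<in>X. cinner x b = 0}"

lemma csubspace_orth_compl: "csubspace (orth_compl X)"
  by (auto intro!: complex_vector.subspaceI
      simp: orth_compl_def cinner_add_left cinner_scaleC_left)

lemma closed_orth_compl: "closed (orth_compl X)"
proof -
  have "orth_compl X = (\<Inter>b\<in>X. {x. cinner x b = 0})"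
    by (auto simp: orth_compl_def)
  moreover have "closed {x. cinner x b = 0}" for b :: 'a
    by (intro closed_Collect_eq linear_continuous_on continuous_on_const bounded_linear_cinner_left)
  ultimately show ?thesis
    by auto
qed

text \<open>First-order condition for a minimum at \<open>t = 0\<close>: for small \<open>t\<close>
  the linear term dominates, so a nonzero slope would give a negative value. All variational
  arguments below end here.\<close>

lemma quadratic_nonneg_imp_linear_zero:
  fixes a b :: real
  assumes "\<And>t. 0 \<le> t * a + t\<^sup>2 * b"
  shows "a = 0"
proof (rule ccontr)
  assume "a \<noteq> 0"
  \<comment> \<open>Positive and larger than \<open>b\<close> whatever the sign of \<open>b\<close>,
    so the single test value \<open>t = - a / c\<close> suffices.\<close>
  define c where "c = \<bar>b\<bar> + 1"
  have "0 < c" "b < c"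
    by (auto simp: c_def)
  then have "(- a / c) * a + (- a / c)\<^sup>2 * b = a\<^sup>2 * (b - c) / c\<^sup>2"
    by (simp add: field_simps power2_eq_square)
  also have "\<dots> < 0"
    using \<open>a \<noteq> 0\<close> \<open>0 < c\<close> \<open>b < c\<close> by (intro divide_neg_pos mult_pos_neg) auto
  finally show False
    using assms[of "- a / c"] by simp
qed

section \<open>Closest points and orthogonal projections\<close>

lemma parallelogram_law:
  "(norm (x + y))\<^sup>2 + (norm (x - y))\<^sup>2 = 2 * (norm x)\<^sup>2 + 2 * (norm y)\<^sup>2"
  for x :: "'a::complex_inner"
  by (simp add: norm_add_squared norm_diff_squared)

text \<open>The sets \<open>S n\<close> of near-minimizers are closed, nonempty and decreasing, and
  the parallelogram law shrinks their diameters to 0; completeness yields a common point, which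
  realizes the infimum.\<close>

lemma closest_point_exists:
  fixes M :: "'a::chilbert_space set"
  assumes M: "csubspace M" "closed M"
  obtains y where "y \<in> M" "\<And>z. z \<in> M \<Longrightarrow> norm (x - y) \<le> norm (x - z)"
proof -
  define d where "d = (INF z\<in>M. (norm (x - z))\<^sup>2)"
  have bdd: "bdd_below ((\<lambda>z. (norm (x - z))\<^sup>2) ` M)"
    by (auto intro: bdd_belowI[of _ 0])
  have ne: "M \<noteq> {}"
    using M(1) complex_vector.subspace_0 by blast
  have d_le: "d \<le> (norm (x - z))\<^sup>2" if "z \<in> M" for z
    unfolding d_def using that bdd by (intro cINF_lower)
  define S where "S n = {z \<in> M. (norm (x - z))\<^sup>2 \<le> d + inverse (real (Suc n))}" for n
  obtain a where a: "\<And>n. a \<in> S n"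
  proof (rule decreasing_closed_nest[of S])
    show "closed (S n)" for n
    proof -
      have "closed {z. (norm (x - z))\<^sup>2 \<le> d + inverse (real (Suc n))}"
        by (intro closed_Collect_le continuous_intros)
      moreover have "S n = M \<inter> {z. (norm (x - z))\<^sup>2 \<le> d + inverse (real (Suc n))}"
        by (auto simp: S_def)
      ultimately show ?thesis
        using M(2) by auto
    qed
    show "S n \<noteq> {}" for n
    proof -
      have "d < d + inverse (real (Suc n))"
        by simp
      then obtain z where "z \<in> M" "(norm (x - z))\<^sup>2 < d + inverse (real (Suc n))"
        unfolding d_def using cINF_less_iff[OF ne bdd] by blast
      then show ?thesis
        by (auto simp: S_def intro: less_imp_le)
    qed
    show "S n \<subseteq> S m" if "m \<le> n" for m n
    proof -
      have "inverse (real (Suc n)) \<le> inverse (real (Suc m))"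
        using that by (intro le_imp_inverse_le) auto
      then have "d + inverse (real (Suc n)) \<le> d + inverse (real (Suc m))"
        by simp
      then show ?thesis
        unfolding S_def by (blast intro: order_trans)
    qed
    show "\<exists>n. \<forall>u\<in>S n. \<forall>v\<in>S n. dist u v < e" if "0 < e" for e
    proof -
      \<comment> \<open>With slack \<open>inverse (real (Suc n))\<close> in both squared distances,
        the parallelogram law bounds the squared diameter by four times the slack.\<close>
      obtain n where n: "inverse (real (Suc n)) < e\<^sup>2 / 4"
        using reals_Archimedean[of "e\<^sup>2 / 4"] \<open>0 < e\<close> by auto
      have "dist u v < e" if "u \<in> S n" "v \<in> S n" for u v
      proof -
        \<comment> \<open>The midpoint stays in \<open>M\<close>, so its squared distance to
          \<open>x\<close> is at least \<open>d\<close>; this is what forces \<open>u\<close> and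
          \<open>v\<close> together.\<close>
        have "(1/2) *\<^sub>R (u + v) \<in> M"
          using that M(1) by (auto simp: S_def intro!: scaleR_in_csubspace complex_vector.subspace_add)
        then have "d \<le> (norm (x - (1/2) *\<^sub>R (u + v)))\<^sup>2"
          by (rule d_le)
        also have "x - (1/2) *\<^sub>R (u + v) = (1/2) *\<^sub>R ((x - u) + (x - v))"
          by (simp add: algebra_simps flip: scaleR_left_distrib)
        also have "(norm \<dots>)\<^sup>2 = (norm ((x - u) + (x - v)))\<^sup>2 / 4"
          by (simp only: norm_scaleR) (simp add: power2_eq_square)
        finally have "4 * d \<le> (norm ((x - u) + (x - v)))\<^sup>2"
          by simp
        moreover have "norm ((x - u) - (x - v)) = dist u v"
          by (simp add: dist_norm norm_minus_commute)
        ultimately have "(dist u v)\<^sup>2 \<le> 2 * (norm (x - u))\<^sup>2 + 2 * (norm (x - v))\<^sup>2 - 4 * d"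
          using parallelogram_law[of "x - u" "x - v"] by simp
        also have "\<dots> < e\<^sup>2"
          using that n by (auto simp: S_def)
        finally show ?thesis
          using \<open>0 < e\<close> by (simp add: power2_less_imp_less)
      qed
      then show ?thesis
        by blast
    qed
  qed blast
  have "(norm (x - a))\<^sup>2 \<le> d + e" if "0 < e" for e
  proof -
    obtain n where "inverse (real (Suc n)) < e"
      using reals_Archimedean[OF \<open>0 < e\<close>] by auto
    then show ?thesis
      using a[of n] by (auto simp: S_def)
  qed
  then have "(norm (x - a))\<^sup>2 \<le> d"
    by (rule field_le_epsilon)
  then have "norm (x - a) \<le> norm (x - z)" if "z \<in> M" for z
    using d_le[OF that] by (meson order_trans norm_ge_zero power2_le_imp_le)
  moreover have "a \<in> M"
    using a[of 0] by (auto simp: S_def)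
  ultimately show ?thesis
    using that by blast
qed

text \<open>Moving the closest point by \<open>t *\<^sub>R z\<close> cannot decrease the distance,
  so the first-order condition makes the residual orthogonal to \<open>M\<close>. Two candidates
  differ by an element of \<open>M\<close> orthogonal to itself.\<close>

lemma orth_decomposition_exists:
  fixes M :: "'a::chilbert_space set"
  assumes M: "csubspace M" "closed M"
  shows "\<exists>!y. y \<in> M \<and> (\<forall>z\<in>M. cinner (x - y) z = 0)"
proof -
  obtain y where y: "y \<in> M" "\<And>z. z \<in> M \<Longrightarrow> norm (x - y) \<le> norm (x - z)"
    using closest_point_exists[OF M] by blast
  have Re0: "Re (cinner (x - y) z) = 0" if "z \<in> M" for z
  proof -
    have "0 \<le> t * (- 2 * Re (cinner (x - y) z)) + t\<^sup>2 * (norm z)\<^sup>2" for t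
    proof -
      have "norm (x - y) \<le> norm (x - (y + t *\<^sub>R z))"
        using that y(1) M(1) by (intro y(2) complex_vector.subspace_add scaleR_in_csubspace)
      then have "(norm (x - y))\<^sup>2 \<le> (norm ((x - y) - t *\<^sub>R z))\<^sup>2"
        by (simp add: diff_diff_add)
      then show ?thesis
        unfolding norm_diff_squared[of "x - y"] by (simp add: cinner_scaleR_right power_mult_distrib)
    qed
    from quadratic_nonneg_imp_linear_zero[OF this] show ?thesis
      by simp
  qed
  have "cinner (x - y) z = 0" if "z \<in> M" for z
  proof (rule complex_eqI)
    show "Re (cinner (x - y) z) = Re 0"
      using Re0[OF that] by simp
    \<comment> \<open>The variation only sees real parts. Conjugate linearity in the second argument
      turns the real part at \<open>\<i> *\<^sub>C z\<close> into the imaginary part at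
      \<open>z\<close>.\<close>
    have "\<i> *\<^sub>C z \<in> M"
      using that M(1) by (rule complex_vector.subspace_scale[rotated])
    then show "Im (cinner (x - y) z) = Im 0"
      using Re0[of "\<i> *\<^sub>C z"] by (simp add: cinner_scaleC_right)
  qed
  moreover have "y' = y" if "y' \<in> M" "\<forall>z\<in>M. cinner (x - y') z = 0" for y'
  proof -
    have "y' - y \<in> M"
      using that y M(1) by (simp add: complex_vector.subspace_diff)
    then have "cinner (x - y) (y' - y) - cinner (x - y') (y' - y) = 0"
      using that calculation by simp
    then have "cinner (y' - y) (y' - y) = 0"
      by (simp flip: cinner_diff_left)
    then show ?thesis
      by simp
  qed
  ultimately show ?thesis
    using y(1) by blast
qed

text \<open>\<open>orth_proj\<close> passes through \<open>Blinfun\<close>, so the pointwise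
  projection \<open>p\<close> must first be shown bounded linear: linearity comes from uniqueness of
  the decomposition, the bound 1 from Pythagoras.\<close>

lemma
  fixes M :: "'a::chilbert_space set"
  assumes M: "csubspace M" "closed M"
  shows orth_proj_in: "orth_proj M x \<in> M"
    and orth_proj_orth: "\<And>z. z \<in> M \<Longrightarrow> cinner (x - orth_proj M x) z = 0"
proof -
  define p where "p x = (THE y. y \<in> M \<and> (\<forall>z\<in>M. cinner (x - y) z = 0))" for x
  have p: "p x \<in> M \<and> (\<forall>z\<in>M. cinner (x - p x) z = 0)" for x
    unfolding p_def by (rule theI') (rule orth_decomposition_exists[OF M])
  have p_eq: "p x = y" if "y \<in> M" "\<And>z. z \<in> M \<Longrightarrow> cinner (x - y) z = 0" for x y
    using orth_decomposition_exists[OF M, of x] p[of x] that by blast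
  have "bounded_linear p"
  proof (rule bounded_linear_intro[where K = 1])
    show "p (u + v) = p u + p v" for u v
    proof (rule p_eq)
      show "p u + p v \<in> M"
        using p M(1) by (simp add: complex_vector.subspace_add)
      fix z assume "z \<in> M"
      then show "cinner (u + v - (p u + p v)) z = 0"
        using p by (simp add: add_diff_add cinner_add_left)
    qed
    show "p (r *\<^sub>R u) = r *\<^sub>R p u" for r u
    proof (rule p_eq)
      show "r *\<^sub>R p u \<in> M"
        using p M(1) by (simp add: scaleR_in_csubspace)
      fix z assume "z \<in> M"
      then show "cinner (r *\<^sub>R u - r *\<^sub>R p u) z = 0"
        using p by (simp add: cinner_scaleR_left flip: scaleR_diff_right)
    qed
    show "norm (p u) \<le> norm u * 1" for u
    proof -
      have "(norm ((u - p u) + p u))\<^sup>2 = (norm (u - p u))\<^sup>2 + (norm (p u))\<^sup>2"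
        unfolding norm_add_squared using p by simp
      then have "(norm (p u))\<^sup>2 \<le> (norm u)\<^sup>2"
        by simp
      then show ?thesis
        by (simp add: power2_le_iff_abs_le)
    qed
  qed
  then have "orth_proj M x = p x"
    by (simp add: orth_proj_def p_def[abs_def] bounded_linear_Blinfun_apply)
  with p show "orth_proj M x \<in> M" "\<And>z. z \<in> M \<Longrightarrow> cinner (x - orth_proj M x) z = 0"
    by auto
qed

lemma orth_proj_eqI:
  fixes M :: "'a::chilbert_space set"
  assumes "csubspace M" "closed M" "y \<in> M" "\<And>z. z \<in> M \<Longrightarrow> cinner (x - y) z = 0"
  shows "orth_proj M x = y"
  using orth_decomposition_exists[OF assms(1,2), of x] orth_proj_in[OF assms(1,2)]
    orth_proj_orth[OF assms(1,2)] assms(3,4) by blast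

section \<open>Complex-linear operators, density, Riesz representation and adjoints\<close>

lemma bounded_ops_scaleC: "T \<in> bounded_ops \<Longrightarrow> T (c *\<^sub>C x) = c *\<^sub>C T x"
  by (simp add: bounded_ops_def Vector_Spaces.linear_iff)

lemma bounded_opsI: "(\<And>c x. T (c *\<^sub>C x) = c *\<^sub>C T x) \<Longrightarrow> T \<in> bounded_ops"
  for T :: "'a::complex_inner \<Rightarrow>\<^sub>L 'a"
  unfolding bounded_ops_def Vector_Spaces.linear_iff
  by (simp add: complex_vector.vector_space_axioms blinfun.add_right)

lemma orth_proj_bounded_ops:
  fixes M :: "'a::chilbert_space set"
  assumes M: "csubspace M" "closed M"
  shows "orth_proj M \<in> bounded_ops"
proof (rule bounded_opsI, rule orth_proj_eqI[OF M])
  show "c *\<^sub>C orth_proj M x \<in> M" for c x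
    using orth_proj_in[OF M] M(1) by (simp add: complex_vector.subspace_scale)
  show "cinner (c *\<^sub>C x - c *\<^sub>C orth_proj M x) z = 0" if "z \<in> M" for c x z
    using orth_proj_orth[OF M that]
    by (simp add: cinner_scaleC_left flip: complex_vector.scale_right_diff_distrib)
qed

text \<open>The residual of projecting any vector onto the closed span is orthogonal to
  \<open>B\<close>, hence zero.\<close>

lemma closure_cspan_eq_UNIV:
  fixes B :: "'a::chilbert_space set"
  assumes "orth_compl B = {0}"
  shows "closure (cspan B) = UNIV"
proof -
  let ?M = "closure (cspan B)"
  have M: "csubspace ?M" "closed ?M"
    by (simp_all add: csubspace_closure complex_vector.subspace_span)
  have "B \<subseteq> ?M"
    using complex_vector.span_superset closure_subset by blast
  have "x \<in> ?M" for x
  proof -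
    have "x - orth_proj ?M x \<in> orth_compl B"
      using orth_proj_orth[OF M] \<open>B \<subseteq> ?M\<close> by (auto simp: orth_compl_def)
    then show ?thesis
      using assms orth_proj_in[OF M, of x] by simp
  qed
  then show ?thesis
    by blast
qed

text \<open>A vector \<open>v\<close> orthogonal to the kernel of \<open>f\<close> with
  \<open>f v \<noteq> 0\<close> determines \<open>f\<close>: every \<open>x\<close> differs from
  \<open>(f x / f v) *\<^sub>C v\<close> by an element of the kernel.\<close>

lemma riesz_representation:
  fixes f :: "'a::chilbert_space \<Rightarrow> complex"
  assumes f: "bounded_linear f" "\<And>c x. f (c *\<^sub>C x) = c * f x"
  obtains z where "\<And>x. f x = cinner x z"
proof (cases "\<forall>x. f x = 0")
  case True
  then show ?thesis
    using that[of 0] by simp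
next
  case False
  then obtain u where u: "f u \<noteq> 0"
    by blast
  interpret bounded_linear f
    by fact
  let ?N = "{x. f x = 0}"
  have N: "csubspace ?N" "closed ?N"
    using f(2) by (auto intro!: complex_vector.subspaceI closed_Collect_eq linear_continuous_on
        simp: add zero f(1))
  define v where "v = u - orth_proj ?N u"
  have fv: "f v \<noteq> 0"
    using u orth_proj_in[OF N, of u] by (simp add: v_def diff)
  then have v0: "v \<noteq> 0"
    using zero by auto
  \<comment> \<open>The multiple of \<open>v\<close> is scaled so that both sides agree at
    \<open>x = v\<close>.\<close>
  have "f x = cinner x ((cnj (f v) / of_real ((norm v)\<^sup>2)) *\<^sub>C v)" for x
  proof -
    have "x - (f x / f v) *\<^sub>C v \<in> ?N"
      using fv by (simp add: diff f(2))
    then have "cinner (x - (f x / f v) *\<^sub>C v) v = 0"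
      unfolding v_def using orth_proj_orth[OF N] cinner_eq_0_commute by blast
    then show ?thesis
      using fv v0 by (simp add: cinner_diff_left cinner_scaleC_left cinner_scaleC_right cinner_self)
  qed
  then show ?thesis
    using that by blast
qed

lemma cinner_eqI: "(\<And>x. cinner x y = cinner x z) \<Longrightarrow> y = z"
  for y :: "'a::complex_inner"
  using cinner_diff_right[of "y - z" y z] by simp

text \<open>\<open>adj_op\<close> is a definite description, so the adjoint has to be constructed:
  Riesz gives \<open>s y\<close> for each \<open>y\<close>, and nondegeneracy of the scalar product
  gives linearity and uniqueness.\<close>

lemma cinner_adj_op:
  fixes T :: "'a::chilbert_space \<Rightarrow>\<^sub>L 'a"
  assumes T: "T \<in> bounded_ops"
  shows "cinner (T x) y = cinner x (adj_op T y)"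
proof -
  have "\<exists>z. \<forall>x. cinner (T x) y = cinner x z" for y
  proof -
    have "bounded_linear (\<lambda>x. cinner (T x) y)"
      by (rule bounded_linear_compose[OF bounded_linear_cinner_left blinfun.bounded_linear_right])
    moreover have "cinner (T (c *\<^sub>C x)) y = c * cinner (T x) y" for c x
      by (simp add: bounded_ops_scaleC[OF T] cinner_scaleC_left)
    ultimately show ?thesis
      using riesz_representation[of "\<lambda>x. cinner (T x) y"] by blast
  qed
  then obtain s where s: "\<And>x y. cinner (T x) y = cinner x (s y)"
    by metis
  have s_scale: "s (c *\<^sub>C y) = c *\<^sub>C s y" for c y
    by (rule cinner_eqI) (simp add: cinner_scaleC_right flip: s)
  have "bounded_linear s"
  proof (rule bounded_linear_intro[where K = "norm T"])
    show "s (u + v) = s u + s v" for u v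
      by (rule cinner_eqI) (simp add: cinner_add_right flip: s)
    show "s (r *\<^sub>R u) = r *\<^sub>R s u" for r u
      by (rule cinner_eqI) (simp add: cinner_scaleR_right flip: s)
    show "norm (s u) \<le> norm u * norm T" for u
    proof (cases "s u = 0")
      case False
      \<comment> \<open>The defining identity of \<open>s\<close> is tested at
        \<open>x = s u\<close>; one factor \<open>norm (s u)\<close> cancels at the end.\<close>
      have "norm (s u) * norm (s u) = cmod (cinner (T (s u)) u)"
        by (simp add: s cinner_self norm_mult power2_eq_square)
      also have "\<dots> \<le> norm (T (s u)) * norm u"
        by (rule norm_cinner_le)
      also have "\<dots> \<le> norm T * norm (s u) * norm u"
        by (intro mult_right_mono norm_blinfun) simp
      finally have "norm (s u) * norm (s u) \<le> (norm u * norm T) * norm (s u)"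
        by (simp add: mult_ac)
      then show ?thesis
        using False by simp
    qed simp
  qed
  then have app: "blinfun_apply (Blinfun s) = s"
    by (rule bounded_linear_Blinfun_apply)
  have "adj_op T \<in> bounded_ops \<and> (\<forall>x y. cinner (T x) y = cinner x (adj_op T y))"
    unfolding adj_op_def
  proof (rule theI[of _ "Blinfun s"])
    show "Blinfun s \<in> bounded_ops \<and> (\<forall>x y. cinner (T x) y = cinner x (Blinfun s y))"
      by (auto intro!: bounded_opsI simp: app s s_scale)
    show "S = Blinfun s" if "S \<in> bounded_ops \<and> (\<forall>x y. cinner (T x) y = cinner x (S y))" for S
      using that by (intro blinfun_eqI cinner_eqI) (simp add: app flip: s)
  qed
  then show ?thesis
    by blast
qed

subsection \<open>Symmetric operators\<close>

lemma closed_eigenspace: "closed (eigenspace T l)"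
  unfolding eigenspace_def kernel_def
  by (intro closed_Collect_eq linear_continuous_on blinfun.bounded_linear_right continuous_on_const)

lemma mem_eigenspace: "x \<in> eigenspace T l \<longleftrightarrow> T x = l *\<^sub>C x"
  by (simp add: eigenspace_def kernel_def blinfun.diff_left scaleC_op.rep_eq)

lemma csubspace_eigenspace: "T \<in> bounded_ops \<Longrightarrow> csubspace (eigenspace T l)"
  by (rule complex_vector.subspaceI)
    (auto simp: mem_eigenspace blinfun.add_right scaleC_add_right bounded_ops_scaleC scaleC_scaleC mult.commute)

lemma eigenvector_imp_point_spectrum: "T x = l *\<^sub>C x \<Longrightarrow> x \<noteq> 0 \<Longrightarrow> l \<in> point_spectrum T"
  for T :: "'a::complex_inner \<Rightarrow>\<^sub>L 'a"
  by (auto simp: point_spectrum_def)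

text \<open>The strong operator topology is the pullback along \<open>blinfun_apply\<close> of the
  product topology on functions, so convergence at each vector is enough.\<close>

lemma has_sum_sotI:
  fixes f :: "'i \<Rightarrow> ('a::chilbert_space \<Rightarrow>\<^sub>L 'a)" and S :: "'a \<Rightarrow>\<^sub>L 'a"
  assumes "\<And>x. ((\<lambda>F. \<Sum>i\<in>F. f i x) \<longlongrightarrow> S x) (finite_subsets_at_top A)"
  shows "has_sum_sot f S A"
proof -
  let ?g = "\<lambda>F. blinfun_apply (\<Sum>i\<in>F. f i)"
  have "limitin (product_topology (\<lambda>_. euclidean) UNIV) ?g (blinfun_apply S) (finite_subsets_at_top A)"
    using assms by (simp add: limitin_componentwise blinfun.sum_left)
  then have lim: "limitin euclidean ?g (blinfun_apply S) (finite_subsets_at_top A)"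
    by (simp add: euclidean_product_topology)
  show ?thesis
    unfolding has_sum_sot_def limitin_def
  proof (intro conjI allI impI)
    fix U assume "openin strong_operator_topology U \<and> S \<in> U"
    then obtain V where V: "open V" "U = blinfun_apply -` V" "S \<in> U"
      by (auto simp: strong_operator_topology_def openin_pullback_topology)
    then have "eventually (\<lambda>F. ?g F \<in> V) (finite_subsets_at_top A)"
      using lim by (auto simp: limitin_def)
    then show "eventually (\<lambda>F. (\<Sum>i\<in>F. f i) \<in> U) (finite_subsets_at_top A)"
      using V by simp
  qed (simp add: strong_operator_topology_topspace)
qed

text \<open>Replaces the uniqueness of positive square roots: eigenvectors of \<open>S\<^sup>2\<close> are eigenvectors of \<open>S\<close>,
  so \<open>S\<close> is determined on a dense subspace once \<open>S\<^sup>2\<close> is diagonalizable.\<close>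

lemma positive_sqrt_eigenvector:
  fixes S :: "'a::chilbert_space \<Rightarrow>\<^sub>L 'a"
  assumes S: "positive_op S" and r: "r \<ge> 0" and b: "S (S b) = r\<^sup>2 *\<^sub>R b"
  shows "S b = r *\<^sub>R b"
proof (cases "r = 0")
  case True
  \<comment> \<open>Here \<open>S (S b) = 0\<close>. The nonnegative form of \<open>S\<close>
    evaluated at \<open>S b + t *\<^sub>R b\<close> has linear coefficient
    \<open>(norm (S b))\<^sup>2\<close>, which must therefore vanish.\<close>
  have "0 \<le> t * (norm (S b))\<^sup>2 + t\<^sup>2 * Re (cinner (S b) b)" for t
  proof -
    have "cinner (S (S b + t *\<^sub>R b)) (S b + t *\<^sub>R b) \<in> \<real>\<^sub>\<ge>\<^sub>0"
      using S by (simp add: positive_op_def)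
    moreover have "S (S b + t *\<^sub>R b) = t *\<^sub>R S b"
      using b True by (simp add: blinfun.add_right blinfun.scaleR_right)
    ultimately show ?thesis
      by (simp add: cinner_scaleR_left cinner_scaleR_right cinner_add_right cinner_self
          complex_nonneg_Reals_iff power2_eq_square distrib_left mult.assoc)
  qed
  from quadratic_nonneg_imp_linear_zero[OF this] show ?thesis
    using True by simp
next
  case False
  \<comment> \<open>Since \<open>(S + r) (S - r) b = 0\<close>, the vector \<open>w\<close>
    satisfies \<open>S w = - r *\<^sub>R w\<close>, and positivity of \<open>S\<close> leaves only
    \<open>w = 0\<close>.\<close>
  define w where "w = S b - r *\<^sub>R b"
  have "S w = - r *\<^sub>R w"
    using b by (simp add: w_def blinfun.diff_right blinfun.scaleR_right algebra_simps power2_eq_square)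
  then have "cinner (S w) w = of_real (- r * (norm w)\<^sup>2)"
    by (simp add: cinner_scaleR_left cinner_minus_left cinner_self)
  moreover have "cinner (S w) w \<in> \<real>\<^sub>\<ge>\<^sub>0"
    using S by (simp add: positive_op_def)
  ultimately have "0 \<le> - r * (norm w)\<^sup>2"
    by (metis nonneg_Reals_of_real_iff)
  then have "w = 0"
    using r False by (simp add: mult_le_0_iff)
  then show ?thesis
    by (simp add: w_def)
qed

locale symmetric_op =
  fixes T :: "'a::chilbert_space \<Rightarrow>\<^sub>L 'a"
  assumes in_bounded_ops: "T \<in> bounded_ops"
    and symmetric: "cinner (T x) y = cinner x (T y)"
begin

section \<open>Eigenvalues of symmetric operators and minimum attainment\<close>

lemma eigenvalue_real:
  assumes "l \<in> point_spectrum T"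
  shows "l = of_real (Re l)"
proof -
  obtain x where x: "x \<noteq> 0" "T x = l *\<^sub>C x"
    using assms by (auto simp: point_spectrum_def)
  then have "l * cinner x x = cnj l * cinner x x"
    using symmetric[of x x] by (simp add: cinner_scaleC_left cinner_scaleC_right)
  then have "cnj l = l"
    using x by simp
  then show ?thesis
    by (metis Reals_cnj_iff of_real_Re)
qed

lemma eigenvectors_orthogonal:
  assumes "T x = l *\<^sub>C x" "T y = k *\<^sub>C y" "l \<noteq> k"
  shows "cinner x y = 0"
\<comment> \<open>For \<open>y = 0\<close> the scalar \<open>k\<close> need not be an eigenvalue, so
  nothing would make it real.\<close>
proof (cases "y = 0")
  case False
  then have "cnj k = k"
    using eigenvalue_real eigenvector_imp_point_spectrum[OF assms(2)]
    by (metis complex_cnj_complex_of_real)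
  then have "l * cinner x y = k * cinner x y"
    using symmetric[of x y] by (simp add: assms cinner_scaleC_left cinner_scaleC_right)
  then show ?thesis
    using assms(3) by simp
qed simp

lemma orth_compl_invariant:
  assumes X: "\<forall>b\<in>X. \<exists>l. T b = l *\<^sub>C b" and x: "x \<in> orth_compl X"
  shows "T x \<in> orth_compl X"
proof -
  have "cinner (T x) b = 0" if "b \<in> X" for b
    using X x that by (auto simp: symmetric orth_compl_def cinner_scaleC_right)
  then show ?thesis
    by (simp add: orth_compl_def)
qed

text \<open>The form \<open>(norm (T y))\<^sup>2 - m\<^sup>2 * (norm y)\<^sup>2\<close> is
  nonnegative on \<open>M\<close> and zero at \<open>x\<close>, so its first variation at
  \<open>x\<close> vanishes. In the direction \<open>w\<close>, which lies in \<open>M\<close> by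
  invariance, this variation is \<open>2 * (norm w)\<^sup>2\<close>.\<close>

lemma minimizer_square_eigenvector:
  assumes M: "csubspace M" "\<And>y. y \<in> M \<Longrightarrow> T y \<in> M"
    and x: "x \<in> M" "norm (T x) = m * norm x" and "0 \<le> m"
    and min: "\<And>y. y \<in> M \<Longrightarrow> m * norm y \<le> norm (T y)"
  shows "T (T x) = m\<^sup>2 *\<^sub>R x"
proof -
  define w where "w = T (T x) - m\<^sup>2 *\<^sub>R x"
  have w: "w \<in> M"
    using M x by (simp add: w_def complex_vector.subspace_diff scaleR_in_csubspace)
  have "0 \<le> t * (2 * (norm w)\<^sup>2) + t\<^sup>2 * ((norm (T w))\<^sup>2 - m\<^sup>2 * (norm w)\<^sup>2)" for t
  proof -
    have "x + t *\<^sub>R w \<in> M"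
      using M(1) x(1) w by (simp add: complex_vector.subspace_add scaleR_in_csubspace)
    then have "m * norm (x + t *\<^sub>R w) \<le> norm (T (x + t *\<^sub>R w))"
      by (rule min)
    then have "m\<^sup>2 * (norm (x + t *\<^sub>R w))\<^sup>2 \<le> (norm (T x + t *\<^sub>R T w))\<^sup>2"
      using \<open>0 \<le> m\<close> unfolding power_mult_distrib[symmetric]
      by (intro power_mono) (simp_all add: blinfun.add_right blinfun.scaleR_right)
    then have "0 \<le> t * (2 * (Re (cinner (T x) (T w)) - m\<^sup>2 * Re (cinner x w)))
        + t\<^sup>2 * ((norm (T w))\<^sup>2 - m\<^sup>2 * (norm w)\<^sup>2)"
      unfolding norm_add_squared x(2)
      by (simp add: cinner_scaleR_right power_mult_distrib algebra_simps)
    moreover have "Re (cinner (T x) (T w)) - m\<^sup>2 * Re (cinner x w) = Re (cinner w w)"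
      using arg_cong[OF w_def, of "\<lambda>u. Re (cinner u w)"]
      by (simp add: symmetric[of "T x" w] cinner_diff_left cinner_scaleR_left)
    ultimately show ?thesis
      by (simp add: cinner_self)
  qed
  from quadratic_nonneg_imp_linear_zero[OF this] show ?thesis
    by (simp add: w_def)
qed

text \<open>At a minimizer \<open>(T - m) (T + m) x = 0\<close>: either \<open>x\<close> is an
  eigenvector for \<open>- m\<close>, or \<open>T x + m *\<^sub>R x\<close> is one for
  \<open>m\<close>. Both have modulus \<open>m\<close>, hence the lower bound.\<close>

lemma min_attaining_imp_eigenvector:
  assumes M: "csubspace M" "\<And>y. y \<in> M \<Longrightarrow> T y \<in> M" and att: "min_attaining_on M T"
  obtains x l where "x \<in> M" "x \<noteq> 0" "T x = l *\<^sub>C x" "\<And>y. y \<in> M \<Longrightarrow> cmod l * norm y \<le> norm (T y)"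
proof -
  define m where "m = min_modulus_on M T"
  obtain x where x: "x \<in> M" "norm x = 1" "norm (T x) = m"
    using att by (auto simp: min_attaining_on_def m_def)
  then have "0 \<le> m"
    by auto
  have min: "m * norm y \<le> norm (T y)" if "y \<in> M" for y
  proof (cases "y = 0")
    case False
    have "(1 / norm y) *\<^sub>R y \<in> {u \<in> M. norm u = 1}"
      using False that M(1) by (simp add: scaleR_in_csubspace)
    then have "m \<le> norm (T ((1 / norm y) *\<^sub>R y))"
      unfolding m_def min_modulus_on_def by (intro cINF_lower bdd_belowI[of _ 0]) auto
    then show ?thesis
      using False by (simp add: blinfun.scaleR_right field_simps)
  qed simp
  have TT: "T (T x) = m\<^sup>2 *\<^sub>R x"
    using x \<open>0 \<le> m\<close> min by (intro minimizer_square_eigenvector[OF M]) auto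
  show ?thesis
  proof (cases "T x = - m *\<^sub>R x")
    case True
    then have "T x = of_real (- m) *\<^sub>C x"
      by (simp only: scaleC_of_real)
    with x min \<open>0 \<le> m\<close> show ?thesis
      by (intro that[of x "of_real (- m)"]) auto
  next
    case False
    define v where "v = T x + m *\<^sub>R x"
    have "T v = m *\<^sub>R v"
      by (simp add: v_def blinfun.add_right blinfun.scaleR_right TT algebra_simps power2_eq_square)
    then have "T v = of_real m *\<^sub>C v"
      by (simp only: scaleC_of_real)
    moreover have "v \<in> M" "v \<noteq> 0"
      using x M False by (auto simp: v_def complex_vector.subspace_add scaleR_in_csubspace
          add_eq_0_iff2)
    ultimately show ?thesis
      using min \<open>0 \<le> m\<close> by (intro that[of v "of_real m"]) auto
  qed
qed

section \<open>Eigenprojections, their sums, and the size of the point spectrum\<close>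

abbreviation eigenproj :: "complex \<Rightarrow> 'a \<Rightarrow>\<^sub>L 'a" where
  "eigenproj l \<equiv> orth_proj (eigenspace T l)"

lemma eigenproj_eigenvector: "T (eigenproj l x) = l *\<^sub>C eigenproj l x"
  using orth_proj_in[OF csubspace_eigenspace[OF in_bounded_ops] closed_eigenspace]
  by (simp add: mem_eigenspace)

lemma eigenproj_orth: "T z = l *\<^sub>C z \<Longrightarrow> cinner (x - eigenproj l x) z = 0"
  using orth_proj_orth[OF csubspace_eigenspace[OF in_bounded_ops] closed_eigenspace]
  by (simp add: mem_eigenspace)

text \<open>A vector \<open>y\<close> of the span near \<open>x\<close> involves finitely many
  eigenvalues. Once \<open>F\<close> contains them, the residual of the partial sum is orthogonal to
  both the partial sum and \<open>y\<close>, so the partial sum is at least as close to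
  \<open>x\<close> as \<open>y\<close> is.\<close>

lemma sum_eigenproj_tendsto:
  assumes dense: "closure (cspan B) = UNIV" and B: "\<And>b. b \<in> B \<Longrightarrow> \<exists>l. T b = l *\<^sub>C b"
  shows "((\<lambda>F. \<Sum>l\<in>F. eigenproj l x) \<longlongrightarrow> x) (finite_subsets_at_top (point_spectrum T))"
proof (rule tendstoI)
  fix e :: real assume "e > 0"
  then obtain y where y: "y \<in> cspan B" "dist y x < e"
    using dense closure_approachable[of x "cspan B"] by auto
  then obtain t r where t: "finite t" "t \<subseteq> B" "y = (\<Sum>b\<in>t. r b *\<^sub>C b)"
    by (auto simp: complex_vector.span_explicit)
  from B obtain lam where lam: "\<And>b. b \<in> B \<Longrightarrow> T b = lam b *\<^sub>C b"
    by metis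
  \<comment> \<open>\<open>B\<close> may contain 0, whose chosen scalar \<open>lam 0\<close> need
    not be an eigenvalue; hence \<open>t - {0}\<close>.\<close>
  have "dist (\<Sum>l\<in>F. eigenproj l x) x < e"
    if F: "finite F" "lam ` (t - {0}) \<subseteq> F" for F
  proof -
    let ?s = "\<Sum>l\<in>F. eigenproj l x"
    have orth: "cinner (x - ?s) v = 0" if "T v = k *\<^sub>C v" "k \<in> F" for v k
    proof -
      have "cinner (eigenproj l x) v = 0" if "l \<in> F - {k}" for l
        using that eigenvectors_orthogonal[OF eigenproj_eigenvector \<open>T v = k *\<^sub>C v\<close>] by auto
      then have "cinner ?s v = cinner (eigenproj k x) v"
        using F \<open>k \<in> F\<close> by (simp add: cinner_sum_left sum.remove[of F k] cinner_add_left)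
      then show ?thesis
        using eigenproj_orth[OF that(1), of x] by (simp add: cinner_diff_left)
    qed
    have "cinner (x - ?s) y = 0"
      unfolding t(3) cinner_sum_right
    proof (intro sum.neutral ballI)
      fix b assume "b \<in> t"
      then show "cinner (x - ?s) (r b *\<^sub>C b) = 0"
        using orth[OF lam, of b] t(2) F(2) by (cases "b = 0") (auto simp: cinner_scaleC_right)
    qed
    moreover have "cinner (x - ?s) ?s = 0"
      unfolding cinner_sum_right[where f = "\<lambda>l. eigenproj l x"]
      by (intro sum.neutral ballI orth[OF eigenproj_eigenvector])
    ultimately have "(norm ((x - ?s) + (?s - y)))\<^sup>2 = (norm (x - ?s))\<^sup>2 + (norm (?s - y))\<^sup>2"
      unfolding norm_add_squared by (simp add: cinner_diff_right)
    then have "(norm (x - ?s))\<^sup>2 \<le> (norm (x - y))\<^sup>2"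
      by simp
    then have "norm (x - ?s) \<le> norm (x - y)"
      by (rule power2_le_imp_le) simp
    then show ?thesis
      using y(2) by (simp add: dist_norm norm_minus_commute)
  qed
  moreover have "lam ` (t - {0}) \<subseteq> point_spectrum T"
    using t(2) lam by (auto intro!: eigenvector_imp_point_spectrum)
  ultimately show "\<forall>\<^sub>F F in finite_subsets_at_top (point_spectrum T).
      dist (\<Sum>l\<in>F. eigenproj l x) x < e"
    using t(1) by (auto simp: eventually_finite_subsets_at_top intro!: exI[of _ "lam ` (t - {0})"])
qed

text \<open>Unit eigenvectors for distinct eigenvalues are orthogonal, thus at distance
  \<open>sqrt 2\<close>. Points of a countable dense set within \<open>1/2\<close> of them are
  therefore distinct, which injects the point spectrum into that set.\<close>

lemma countable_point_spectrum:
  assumes "separable_space (euclidean :: 'a topology)"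
  shows "countable (point_spectrum T)"
proof -
  obtain D :: "'a set" where D: "countable D" "closure D = UNIV"
    using assms by (auto simp: separable_space_def)
  have "\<exists>d u. d \<in> D \<and> T u = l *\<^sub>C u \<and> norm u = 1 \<and> dist d u < 1/2"
    if l: "l \<in> point_spectrum T" for l
  proof -
    obtain x where x: "x \<noteq> 0" "T x = l *\<^sub>C x"
      using l by (auto simp: point_spectrum_def)
    define u where "u = (1 / norm x) *\<^sub>R x"
    have "u = of_real (1 / norm x) *\<^sub>C x"
      by (simp only: u_def scaleC_of_real)
    then have "T u = l *\<^sub>C u"
      using x by (simp add: bounded_ops_scaleC[OF in_bounded_ops] scaleC_scaleC mult.commute)
    moreover have "norm u = 1"
      using x by (simp add: u_def)
    moreover have "\<exists>d\<in>D. dist d u < 1/2"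
      using D(2) closure_approachable[of u D] by (metis UNIV_I half_gt_zero zero_less_one)
    ultimately show ?thesis
      by blast
  qed
  then obtain d u where du: "\<And>l. l \<in> point_spectrum T \<Longrightarrow>
      d l \<in> D \<and> T (u l) = l *\<^sub>C u l \<and> norm (u l) = 1 \<and> dist (d l) (u l) < 1/2"
    by metis
  have "inj_on d (point_spectrum T)"
  proof (rule inj_onI, rule ccontr)
    fix l k assume lk: "l \<in> point_spectrum T" "k \<in> point_spectrum T" "d l = d k" "l \<noteq> k"
    then have "cinner (u l) (u k) = 0"
      using du eigenvectors_orthogonal by blast
    then have "(dist (u l) (u k))\<^sup>2 = 2"
      using du[OF lk(1)] du[OF lk(2)] by (simp add: dist_norm norm_diff_squared)
    moreover have "dist (u l) (u k) < 1"
      using du[OF lk(1)] du[OF lk(2)] lk(3) dist_triangle_half_r by metis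
    ultimately show False
      by (smt (verit) power_le_one zero_le_dist)
  qed
  moreover have "d ` point_spectrum T \<subseteq> D"
    using du by blast
  ultimately show ?thesis
    using D(1) countable_image_inj_on countable_subset by blast
qed

lemma cmod_eigenvalue_le_norm:
  assumes "l \<in> point_spectrum T"
  shows "cmod l \<le> norm T"
proof -
  obtain x where x: "x \<noteq> 0" "T x = l *\<^sub>C x"
    using assms by (auto simp: point_spectrum_def)
  then have "cmod l * norm x \<le> norm T * norm x"
    using norm_blinfun[of T x] by (simp add: norm_scaleC)
  then show ?thesis
    using x by simp
qed

end

subsection \<open>Spectral decomposition\<close>

locale symmetric_M_r_op = symmetric_op +
  assumes in_M_r: "T \<in> M_r"
begin

section \<open>Diagonalizability through a maximal orthonormal set of eigenvectors\<close>

lemma adj_op_eq: "adj_op T = T"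
  by (intro blinfun_eqI cinner_eqI)
    (simp add: symmetric flip: cinner_adj_op[OF in_bounded_ops])

text \<open>The one place where membership in \<open>M_r\<close> enters: by symmetry the complement
  of a set of eigenvectors reduces \<open>T\<close>, so the minimum modulus is attained
  there.\<close>

lemma orth_compl_min_eigenvector:
  assumes X: "\<forall>b\<in>X. \<exists>l. T b = l *\<^sub>C b" and ne: "orth_compl X \<noteq> {0}"
  obtains x l where "x \<in> orth_compl X" "x \<noteq> 0" "T x = l *\<^sub>C x"
    "\<And>y. y \<in> orth_compl X \<Longrightarrow> cmod l * norm y \<le> norm (T y)"
proof -
  have "reduces (orth_compl X) T"
    using orth_compl_invariant[OF X]
    by (auto simp: reduces_def csubspace_orth_compl closed_orth_compl adj_op_eq)
  then have "min_attaining_on (orth_compl X) T"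
    using in_M_r ne by (simp add: M_r_def)
  then show ?thesis
    using min_attaining_imp_eigenvector[OF csubspace_orth_compl orth_compl_invariant[OF X]] that
    by blast
qed

lemma eigenbasis_exists:
  obtains B where "orthonormal_basis B" "\<And>b. b \<in> B \<Longrightarrow> \<exists>l. T b = l *\<^sub>C b"
proof -
  define \<A> where "\<A> = {B. (\<forall>b\<in>B. norm b = 1 \<and> (\<exists>l. T b = l *\<^sub>C b)) \<and>
      (\<forall>b\<in>B. \<forall>c\<in>B. b \<noteq> c \<longrightarrow> cinner b c = 0)}"
  have "\<exists>B\<in>\<A>. \<forall>X\<in>\<A>. B \<subseteq> X \<longrightarrow> X = B"
  proof (rule subset_Zorn')
    fix C assume C: "subset.chain \<A> C"
    \<comment> \<open>Of two members of a chain one contains the other, so both vectors lie in a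
      single orthonormal set.\<close>
    have "cinner b c = 0" if "b \<in> X" "c \<in> Y" "X \<in> C" "Y \<in> C" "b \<noteq> c" for b c X Y
    proof -
      have "X \<subseteq> Y \<or> Y \<subseteq> X"
        using C that unfolding subset_chain_def by blast
      moreover have "X \<in> \<A>" "Y \<in> \<A>"
        using C that unfolding subset_chain_def by blast+
      ultimately show ?thesis
        using that unfolding \<A>_def by blast
    qed
    moreover have "norm b = 1 \<and> (\<exists>l. T b = l *\<^sub>C b)" if "b \<in> X" "X \<in> C" for b X
      using C that unfolding subset_chain_def \<A>_def by blast
    ultimately show "\<Union> C \<in> \<A>"
      unfolding \<A>_def by blast
  qed
  then obtain B where B: "B \<in> \<A>" and max: "\<And>X. X \<in> \<A> \<Longrightarrow> B \<subseteq> X \<Longrightarrow> X = B"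
    by blast
  have eig: "\<forall>b\<in>B. \<exists>l. T b = l *\<^sub>C b"
    using B by (simp add: \<A>_def)
  have "orth_compl B = {0}"
  proof (rule ccontr)
    assume "orth_compl B \<noteq> {0}"
    then obtain x l where x: "x \<in> orth_compl B" "x \<noteq> 0" "T x = l *\<^sub>C x"
      using orth_compl_min_eigenvector[OF eig] by blast
    define u where "u = (1 / norm x) *\<^sub>R x"
    have u: "u \<in> orth_compl B" "norm u = 1"
      using x by (simp_all add: u_def scaleR_in_csubspace csubspace_orth_compl)
    have "u = of_real (1 / norm x) *\<^sub>C x"
      by (simp only: u_def scaleC_of_real)
    then have "T u = l *\<^sub>C u"
      using x by (simp add: bounded_ops_scaleC[OF in_bounded_ops] scaleC_scaleC mult.commute)
    moreover have "cinner u b = 0 \<and> cinner b u = 0" if "b \<in> B" for b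
      using u(1) that cinner_eq_0_commute by (auto simp: orth_compl_def)
    \<comment> \<open>Maximality puts the new unit eigenvector into \<open>B\<close>, although it is
      orthogonal to all of \<open>B\<close>.\<close>
    ultimately have "insert u B \<in> \<A>"
      using B u(2) unfolding \<A>_def by auto
    then have "u \<in> B"
      using max by blast
    then have "cinner u u = 0"
      using u(1) by (auto simp: orth_compl_def)
    then show False
      using u(2) by auto
  qed
  then have "orthonormal_basis B"
    using B closure_cspan_eq_UNIV by (auto simp: orthonormal_basis_def \<A>_def)
  then show ?thesis
    using that eig by blast
qed

lemma diagonalizable: "diagonalizable T"
proof -
  obtain B where B: "orthonormal_basis B" "\<And>b. b \<in> B \<Longrightarrow> \<exists>l. T b = l *\<^sub>C b"
    using eigenbasis_exists by blast
  then have "\<forall>b\<in>B. b \<noteq> 0"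
    by (auto simp: orthonormal_basis_def)
  with B show ?thesis
    unfolding diagonalizable_def by blast
qed

section \<open>Well-ordering of the moduli of eigenvalues\<close>

lemma eigenvalue_modulus_least:
  assumes S: "S \<noteq> {}" "S \<subseteq> cmod ` point_spectrum T"
  shows "\<exists>m\<in>S. \<forall>s\<in>S. m \<le> s"
proof -
  \<comment> \<open>Removing these eigenvectors keeps all those with modulus in \<open>S\<close>, as
    different moduli mean different eigenvalues. The minimizing eigenvector of the complement has
    modulus in \<open>S\<close>, since otherwise it would be orthogonal to itself.\<close>
  define X where "X = {b. \<exists>l. T b = l *\<^sub>C b \<and> cmod l \<notin> S}"
  have X: "\<forall>b\<in>X. \<exists>l. T b = l *\<^sub>C b"
    by (auto simp: X_def)
  have in_X: "y \<in> orth_compl X" if "T y = k *\<^sub>C y" "cmod k \<in> S" for y k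
    using that eigenvectors_orthogonal by (auto simp: X_def orth_compl_def)
  have eig: "\<exists>y k. y \<noteq> 0 \<and> T y = k *\<^sub>C y \<and> cmod k = s" if "s \<in> S" for s
    using S that by (fastforce simp: point_spectrum_def)
  obtain s where "s \<in> S"
    using S(1) by blast
  then obtain y k where "y \<noteq> 0" "T y = k *\<^sub>C y" "cmod k \<in> S"
    using eig by blast
  then have "orth_compl X \<noteq> {0}"
    using in_X by blast
  then obtain x l where x: "x \<in> orth_compl X" "x \<noteq> 0" "T x = l *\<^sub>C x"
    and min: "\<And>y. y \<in> orth_compl X \<Longrightarrow> cmod l * norm y \<le> norm (T y)"
    using orth_compl_min_eigenvector[OF X] by blast
  have "cmod l \<in> S"
  proof (rule ccontr)
    assume "cmod l \<notin> S"
    then have "x \<in> X"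
      using x by (auto simp: X_def)
    then have "cinner x x = 0"
      using x(1) by (auto simp: orth_compl_def)
    then show False
      using x(2) by simp
  qed
  moreover have "cmod l \<le> s" if s: "s \<in> S" for s
  proof -
    obtain y k where y: "y \<noteq> 0" "T y = k *\<^sub>C y" "cmod k = s"
      using eig[OF s] by blast
    then have "cmod l * norm y \<le> s * norm y"
      using min[OF in_X[OF y(2)]] s by (simp add: norm_scaleC)
    then show ?thesis
      using y(1) by simp
  qed
  ultimately show ?thesis
    by blast
qed

lemma well_order_on_eigenvalue_moduli:
  defines "\<Gamma> \<equiv> cmod ` point_spectrum T"
  shows "well_order_on \<Gamma> {(x, y). x \<in> \<Gamma> \<and> y \<in> \<Gamma> \<and> x \<le> y}"
proof -
  let ?r = "{(x, y). x \<in> \<Gamma> \<and> y \<in> \<Gamma> \<and> x \<le> y}"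
  have "wf (?r - Id)"
    unfolding wf_eq_minimal
  proof (intro allI impI)
    fix Q and x :: real assume "x \<in> Q"
    show "\<exists>z\<in>Q. \<forall>y. (y, z) \<in> ?r - Id \<longrightarrow> y \<notin> Q"
    \<comment> \<open>Well-foundedness quantifies over arbitrary sets of reals. A set missing
      \<open>\<Gamma>\<close> has only minimal elements, because the relation lives on
      \<open>\<Gamma>\<close>.\<close>
    proof (cases "Q \<inter> \<Gamma> = {}")
      case True
      with \<open>x \<in> Q\<close> show ?thesis
        by blast
    next
      case False
      then obtain m where "m \<in> Q \<inter> \<Gamma>" "\<forall>s\<in>Q \<inter> \<Gamma>. m \<le> s"
        using eigenvalue_modulus_least[of "Q \<inter> \<Gamma>"] by (auto simp: \<Gamma>_def)
      then show ?thesis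
        by (intro bexI[of _ m]) force+
    qed
  qed
  then show ?thesis
    by (auto simp: order_on_defs refl_on_def trans_def antisym_def total_on_def)
qed

section \<open>Expansion over eigenspaces and identification of the modulus\<close>

lemma eigenproj_sum_tendsto:
  "((\<lambda>F. \<Sum>l\<in>F. A (eigenproj l x)) \<longlongrightarrow> A x) (finite_subsets_at_top (point_spectrum T))"
  for A :: "'a \<Rightarrow>\<^sub>L 'a"
proof -
  obtain B where "orthonormal_basis B" "\<And>b. b \<in> B \<Longrightarrow> \<exists>l. T b = l *\<^sub>C b"
    using eigenbasis_exists by blast
  then have "((\<lambda>F. \<Sum>l\<in>F. eigenproj l x) \<longlongrightarrow> x) (finite_subsets_at_top (point_spectrum T))"
    using sum_eigenproj_tendsto by (auto simp: orthonormal_basis_def)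
  \<comment> \<open>Continuity of \<open>A\<close> carries the expansion of \<open>x\<close> over to
    \<open>A x\<close>; \<open>T\<close> and \<open>abs_op T\<close> are later taken for
    \<open>A\<close>.\<close>
  from blinfun.tendsto[OF tendsto_const this, of A] show ?thesis
    by (simp add: blinfun.sum_right)
qed

lemma blinfun_eqI_eigenvectors:
  fixes A S :: "'a \<Rightarrow>\<^sub>L 'a"
  assumes "\<And>l b. l \<in> point_spectrum T \<Longrightarrow> T b = l *\<^sub>C b \<Longrightarrow> A b = S b"
  shows "A = S"
proof (rule blinfun_eqI)
  fix x
  have "\<forall>\<^sub>F F in finite_subsets_at_top (point_spectrum T).
      (\<Sum>l\<in>F. A (eigenproj l x)) = (\<Sum>l\<in>F. S (eigenproj l x))"
    using assms eigenproj_eigenvector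
    by (intro eventually_finite_subsets_at_top_weakI sum.cong) auto
  then have "((\<lambda>F. \<Sum>l\<in>F. S (eigenproj l x)) \<longlongrightarrow> A x) (finite_subsets_at_top (point_spectrum T))"
    using eigenproj_sum_tendsto[of A x] by (simp add: tendsto_cong)
  then show "A x = S x"
    using eigenproj_sum_tendsto[of S x] tendsto_unique finite_subsets_at_top_neq_bot by blast
qed

text \<open>The sign of \<open>T\<close> is the reflection \<open>2 Q - I\<close>, where \<open>Q\<close> projects onto the complement of
  the eigenvectors with negative eigenvalues; so \<open>|T| = T (2 Q - I)\<close>.\<close>

lemma modulus_exists:
  obtains A where "A \<in> bounded_ops" "\<And>l b. l \<in> point_spectrum T \<Longrightarrow> T b = l *\<^sub>C b \<Longrightarrow> A b = cmod l *\<^sub>R b"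
proof -
  define N where "N = orth_compl {b. \<exists>l. T b = l *\<^sub>C b \<and> Re l < 0}"
  have N: "csubspace N" "closed N"
    by (simp_all add: N_def csubspace_orth_compl closed_orth_compl)
  define A where "A = T o\<^sub>L (2 *\<^sub>R orth_proj N - id_blinfun)"
  have app: "A x = T (2 *\<^sub>R orth_proj N x - x)" for x
    by (simp add: A_def blinfun.diff_left blinfun.scaleR_left)
  have "A (c *\<^sub>C x) = c *\<^sub>C A x" for c x
  proof -
    have "2 *\<^sub>R c *\<^sub>C orth_proj N x = c *\<^sub>C 2 *\<^sub>R orth_proj N x"
      by (simp add: scaleC_scaleC mult.commute flip: scaleC_of_real)
    then show ?thesis
      by (simp add: app bounded_ops_scaleC[OF orth_proj_bounded_ops[OF N]]
          bounded_ops_scaleC[OF in_bounded_ops]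
          flip: complex_vector.scale_right_diff_distrib)
  qed
  then have "A \<in> bounded_ops"
    by (rule bounded_opsI)
  moreover have "A b = cmod l *\<^sub>R b" if l: "l \<in> point_spectrum T" and b: "T b = l *\<^sub>C b" for l b
  proof -
    obtain r where r: "l = of_real r"
      using eigenvalue_real[OF l] by blast
    show ?thesis
    proof (cases "Re l < 0")
      case True
      \<comment> \<open>\<open>N\<close> is by definition orthogonal to \<open>b\<close>, so the
        reflection sends \<open>b\<close> to \<open>- b\<close>.\<close>
      have "orth_proj N b = 0"
      proof (rule orth_proj_eqI[OF N])
        show "0 \<in> N"
          using N(1) by (rule complex_vector.subspace_0)
        show "cinner (b - 0) z = 0" if "z \<in> N" for z
          using that b True cinner_eq_0_commute[of b z] by (auto simp: N_def orth_compl_def)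
      qed
      then have "A b = (- l) *\<^sub>C b"
        by (simp add: app b blinfun.minus_right)
      also have "- l = of_real (cmod l)"
        using True r by simp
      finally show ?thesis
        by (simp only: scaleC_of_real)
    next
      case False
      \<comment> \<open>Its eigenvalue differs from every negative one, so \<open>b\<close> is
        orthogonal to all their eigenvectors and is fixed by the reflection.\<close>
      have "b \<in> N"
        using b False eigenvectors_orthogonal by (auto simp: N_def orth_compl_def)
      then have "orth_proj N b = b"
        by (intro orth_proj_eqI[OF N]) auto
      then have "A b = l *\<^sub>C b"
        by (simp add: app b scaleR_2)
      also have "l = of_real (cmod l)"
        using False r by simp
      finally show ?thesis
        by (simp only: scaleC_of_real norm_of_real abs_norm_cancel)
    qed
  qed
  ultimately show ?thesis
    using that by blast
qed

text \<open>\<open>sqrt_op\<close> is a definite description, so the operator \<open>A\<close> of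
  \<open>modulus_exists\<close> is shown to be the only positive square root of
  \<open>T o\<^sub>L T\<close>; eigenvectors suffice for comparing squares and for
  uniqueness.\<close>

lemma abs_op_eigenvector:
  assumes l: "l \<in> point_spectrum T" and b: "T b = l *\<^sub>C b"
  shows "abs_op T b = cmod l *\<^sub>R b"
proof -
  obtain A where A: "A \<in> bounded_ops"
    "\<And>l b. l \<in> point_spectrum T \<Longrightarrow> T b = l *\<^sub>C b \<Longrightarrow> A b = cmod l *\<^sub>R b"
    using modulus_exists by blast
  have TT: "T (T b) = (cmod l)\<^sup>2 *\<^sub>R b" if lb: "l \<in> point_spectrum T" "T b = l *\<^sub>C b" for l b
  proof -
    obtain r where r: "l = of_real r"
      using eigenvalue_real[OF lb(1)] by blast
    have "T (T b) = (l * l) *\<^sub>C b"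
      using lb by (simp add: bounded_ops_scaleC[OF in_bounded_ops] scaleC_scaleC)
    also have "l * l = of_real ((cmod l)\<^sup>2)"
      using r by (simp add: power2_eq_square)
    finally show ?thesis
      by (simp only: scaleC_of_real)
  qed
  have "positive_op A"
    unfolding positive_op_def
  proof (intro conjI allI)
    fix x
    \<comment> \<open>\<open>cinner (A x) x\<close> is a limit of the sums of
      \<open>cmod l * (norm (eigenproj l x))\<^sup>2\<close>, and the nonnegative reals are
      closed.\<close>
    have "((\<lambda>F. cinner (\<Sum>l\<in>F. A (eigenproj l x)) x) \<longlongrightarrow> cinner (A x) x)
        (finite_subsets_at_top (point_spectrum T))"
      by (rule bounded_linear.tendsto[OF bounded_linear_cinner_left eigenproj_sum_tendsto])
    moreover have "\<forall>\<^sub>F F in finite_subsets_at_top (point_spectrum T).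
        cinner (\<Sum>l\<in>F. A (eigenproj l x)) x \<in> \<real>\<^sub>\<ge>\<^sub>0"
    proof (rule eventually_finite_subsets_at_top_weakI)
      fix F assume F: "F \<subseteq> point_spectrum T"
      have "cinner (eigenproj l x) x = of_real ((norm (eigenproj l x))\<^sup>2)" for l
        using eigenproj_orth[OF eigenproj_eigenvector, of x l x]
          cinner_eq_0_commute[of "x - eigenproj l x" "eigenproj l x"]
        by (simp add: cinner_diff_right cinner_self)
      then have "cinner (\<Sum>l\<in>F. A (eigenproj l x)) x
          = (\<Sum>l\<in>F. of_real (cmod l * (norm (eigenproj l x))\<^sup>2))"
        unfolding cinner_sum_left using F A(2)[OF _ eigenproj_eigenvector]
        by (intro sum.cong) (auto simp: cinner_scaleR_left)
      also have "\<dots> = of_real (\<Sum>l\<in>F. cmod l * (norm (eigenproj l x))\<^sup>2)"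
        by simp
      finally show "cinner (\<Sum>l\<in>F. A (eigenproj l x)) x \<in> \<real>\<^sub>\<ge>\<^sub>0"
        by (simp only: nonneg_Reals_of_real_iff) (simp add: sum_nonneg)
    qed
    ultimately show "cinner (A x) x \<in> \<real>\<^sub>\<ge>\<^sub>0"
      by (rule Lim_in_closed_set[OF closed_nonneg_Reals_complex _ finite_subsets_at_top_neq_bot, rotated])
  qed (fact A(1))
  moreover have "A o\<^sub>L A = T o\<^sub>L T"
  proof (rule blinfun_eqI_eigenvectors)
    fix l b assume lb: "l \<in> point_spectrum T" "T b = l *\<^sub>C b"
    show "(A o\<^sub>L A) b = (T o\<^sub>L T) b"
      using A(2)[OF lb] TT[OF lb] by (simp add: blinfun.scaleR_right power2_eq_square)
  qed
  moreover have "S = A" if S: "positive_op S" "S o\<^sub>L S = T o\<^sub>L T" for S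
  proof (rule blinfun_eqI_eigenvectors)
    fix l b assume lb: "l \<in> point_spectrum T" "T b = l *\<^sub>C b"
    have "S (S b) = (cmod l)\<^sup>2 *\<^sub>R b"
      using arg_cong[OF S(2), of "\<lambda>U. blinfun_apply U b"] TT[OF lb] by simp
    then show "S b = A b"
      using A(2)[OF lb] positive_sqrt_eigenvector[OF S(1), of "cmod l" b] by simp
  qed
  ultimately have "abs_op T = A"
    unfolding abs_op_def sqrt_op_def adj_op_eq by (intro the_equality) blast+
  then show ?thesis
    using A(2)[OF l b] by simp
qed

text \<open>Common form of the two series: each term is \<open>A\<close> applied after an
  eigenprojection, on whose range \<open>A\<close> acts as a scalar.\<close>

lemma has_sum_sot_eigenproj:
  fixes A :: "'a \<Rightarrow>\<^sub>L 'a" and f :: "complex \<Rightarrow> ('a \<Rightarrow>\<^sub>L 'a)"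
  assumes "\<And>l x. l \<in> point_spectrum T \<Longrightarrow> f l x = A (eigenproj l x)"
  shows "has_sum_sot f A (point_spectrum T)"
proof (rule has_sum_sotI)
  fix x
  have "\<forall>\<^sub>F F in finite_subsets_at_top (point_spectrum T).
      (\<Sum>l\<in>F. A (eigenproj l x)) = (\<Sum>l\<in>F. f l x)"
    using assms by (intro eventually_finite_subsets_at_top_weakI sum.cong) auto
  then show "((\<lambda>F. \<Sum>l\<in>F. f l x) \<longlongrightarrow> A x) (finite_subsets_at_top (point_spectrum T))"
    using eigenproj_sum_tendsto[of A x] by (simp add: tendsto_cong)
qed

end

theorem theorem4p4:
  fixes T :: "'a::chilbert_space \<Rightarrow>\<^sub>L 'a"
    and \<Gamma> :: "real set"
    and P :: "complex \<Rightarrow> ('a \<Rightarrow>\<^sub>L 'a)"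
  assumes "infinite_dimensional TYPE('a)"
    and "separable_space (euclidean :: 'a topology)"
    and "T \<in> M_r"
    and "self_adjoint T"
    and "\<Gamma> = {cmod l | l. l \<in> point_spectrum T}"
    and "\<And>l. l \<in> point_spectrum T \<Longrightarrow> P l = orth_proj (eigenspace T l)"
  shows "diagonalizable T
    \<and> (\<Gamma> \<subseteq> {0..norm T} \<and> countable \<Gamma> \<and> well_order_on \<Gamma> {(x, y). x \<in> \<Gamma> \<and> y \<in> \<Gamma> \<and> x \<le> y})
    \<and> (has_sum_sot (\<lambda>l. scaleC_op l (P l)) T (point_spectrum T)
       \<and> has_sum_sot (\<lambda>l. cmod l *\<^sub>R P l) (abs_op T) (point_spectrum T))"
proof -
  have "T \<in> bounded_ops"
    using assms(3) by (simp add: M_r_def)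
  \<comment> \<open>Self-adjointness is stated through \<open>adj_op\<close>; its defining identity
    turns it into symmetry.\<close>
  moreover from this have "cinner (T x) y = cinner x (T y)" for x y
    using cinner_adj_op[of T x y] assms(4) by (simp add: self_adjoint_def)
  ultimately interpret symmetric_M_r_op T
    using assms(3) by unfold_locales
  have \<Gamma>: "\<Gamma> = cmod ` point_spectrum T"
    using assms(5) by auto
  show ?thesis
  proof (intro conjI)
    show "diagonalizable T"
      by (rule diagonalizable)
    show "\<Gamma> \<subseteq> {0..norm T}"
      by (auto simp: \<Gamma> cmod_eigenvalue_le_norm)
    show "countable \<Gamma>"
      using countable_point_spectrum[OF assms(2)] by (simp add: \<Gamma>)
    show "well_order_on \<Gamma> {(x, y). x \<in> \<Gamma> \<and> y \<in> \<Gamma> \<and> x \<le> y}"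
      unfolding \<Gamma> by (rule well_order_on_eigenvalue_moduli)
    show "has_sum_sot (\<lambda>l. scaleC_op l (P l)) T (point_spectrum T)"
      by (rule has_sum_sot_eigenproj) (simp add: assms(6) scaleC_op.rep_eq eigenproj_eigenvector)
    show "has_sum_sot (\<lambda>l. cmod l *\<^sub>R P l) (abs_op T) (point_spectrum T)"
      by (rule has_sum_sot_eigenproj)
        (simp add: assms(6) blinfun.scaleR_left abs_op_eigenvector eigenproj_eigenvector)
  qed
qed

end
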